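(* Let $T:\mathbb{R}^n\rightrightarrows\mathbb{R}^n$ be a monotone linear relation. Then: (i) $T_1=T+N_{\operatorname{dom}T}$, i.e. $$T_1x=\begin{cases}Tx+(\operatorname{dom}T)^{\perp}&\text{if }x\in\operatorname{dom}T,\\ \varnothing&\text{otherwise,}\end{cases}$$ is maximally monotone. In particular, $\operatorname{dom}T_1=\operatorname{dom}T$. (ii) $T_2=(T^{-1}+N_{\operatorname{ran}T})^{-1}$ is a maximally monotone extension of $T$ and $\operatorname{ran}T_2=\operatorname{ran}T$.
   Context: $n\in\{1,2,3,\ldots\}$ and $\mathbb{R}^n$ carries the Euclidean inner product $\langle\cdot,\cdot\rangle$. A set-valued operator $T:\mathbb{R}^n\rightrightarrows\mathbb{R}^n$ is identified with its graph $\operatorname{gra}T=\{(x,x^* )\mid x^*\in Tx\}$; it is a linear relation if $\operatorname{gra}T$ is a linear subspace. $\operatorname{dom}T=\{x\mid Tx\ne\varnothing\}$, $\operatorname{ran}T=\bigcup_xTx$, and $T^{-1}$ is the set-valued inverse, $\operatorname{gra}T^{-1}=\{(x^*,x)\mid(x,x^* )\in\operatorname{gra}T\}$. $T$ is monotone if $\langle x-y,x^*-y^*\rangle\ge0$ for all $(x,x^* ),(y,y^* )\in\operatorname{gra}T$, and maximally monotone if it is monotone and has no proper monotone extension (in the sense of graph inclusion, among all set-valued operators). $S$ is an extension of $T$ if $\operatorname{gra}T\subseteq\operatorname{gra}S$. For a closed convex set $C$, $N_C$ is the normal cone operator; for a linear subspace $C$, $N_C(x)=C^{\perp}$ if $x\in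 C$ and $N_C(x)=\varnothing$ otherwise. Sums of operators are pointwise: $(S+T)x=Sx+Tx$ (empty if either is empty). *)

theory Defs
  imports "HOL-Analysis.Analysis"
begin

text \<open>
  A set-valued operator is identified with its graph, so that the value \<open>T x\<close> is
  \<open>T `` {x}\<close>, domain, range and set-valued inverse are \<^const>\<open>Domain\<close>, \<^const>\<open>Range\<close> and
  \<^const>\<open>converse\<close>, extension is inclusion, and a linear relation is an operator \<open>T\<close> with
  \<open>subspace T\<close>, taken in the product vector space.
\<close>

type_synonym 'a operator = "('a \<times> 'a) set"

definition monotone_operator :: "'a::real_inner operator \<Rightarrow> bool" where
  "monotone_operator T \<longleftrightarrow>
     (\<forall>(x, x') \<in> T. \<forall>(y, y') \<in> T. (x - y) \<bullet> (x' - y') \<ge> 0)"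

definition maximally_monotone :: "'a::real_inner operator \<Rightarrow> bool" where
  "maximally_monotone T \<longleftrightarrow>
     monotone_operator T \<and> (\<forall>S. monotone_operator S \<and> T \<subseteq> S \<longrightarrow> S = T)"

text \<open>The sum of values is the Minkowski sum, which is empty if a summand is empty.\<close>

definition operator_sum :: "'a::plus operator \<Rightarrow> 'a operator \<Rightarrow> 'a operator"
    (infixl \<open>\<oplus>\<^sub>o\<close> 65) where
  "S \<oplus>\<^sub>o T = {(x, u). u \<in> S `` {x} + T `` {x}}"

definition normal_cone :: "'a::real_inner set \<Rightarrow> 'a operator" where
  "normal_cone C = {(x, u). x \<in> C \<and> (\<forall>c \<in> C. (c - x) \<bullet> u \<le> 0)}"

lemma normal_cone_subspace:
  assumes "subspace C"
  shows "normal_cone C `` {x} = (if x \<in> C then C\<^sup>\<bottom> else {})"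
proof (cases "x \<in> C")
  case True
  have "(\<forall>c\<in>C. (c - x) \<bullet> u \<le> 0) \<longleftrightarrow> (\<forall>c\<in>C. c \<bullet> u = 0)" for u
  proof
    assume u: "\<forall>c\<in>C. (c - x) \<bullet> u \<le> 0"
    show "\<forall>c\<in>C. c \<bullet> u = 0"
    proof
      fix c assume c: "c \<in> C"
      have "(x + c - x) \<bullet> u \<le> 0"
        using u subspace_add[OF assms True c] by blast
      moreover have "(x - c - x) \<bullet> u \<le> 0"
        using u subspace_diff[OF assms True c] by blast
      ultimately show "c \<bullet> u = 0"
        by (simp add: inner_diff_left inner_add_left)
    qed
  next
    assume "\<forall>c\<in>C. c \<bullet> u = 0"
    with True show "\<forall>c\<in>C. (c - x) \<bullet> u \<le> 0"
      by (simp add: inner_diff_left)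
  qed
  then show ?thesis
    using True unfolding normal_cone_def orthogonal_comp_def orthogonal_def Image_singleton
    by simp
next
  case False
  then show ?thesis
    unfolding normal_cone_def Image_singleton by simp
qed

end

theory Submission
  imports Defs
begin

text \<open>
  Let \<open>D\<close> be the domain of \<open>T\<close> and suppose \<open>(z, w)\<close> is monotonically related to \<open>T + N\<^sub>D\<close>. Write
  \<open>z = p + q\<close> with \<open>p \<in> D\<close>, \<open>q \<in> D\<^sup>\<bottom>\<close>; testing against \<open>(p, p' + t q)\<close> for large \<open>t\<close> forces
  \<open>q = 0\<close>, so \<open>z \<in> D\<close>. Now pick \<open>z' \<in> T z\<close>; testing against \<open>(z + t v, z' + t v')\<close> for small
  \<open>t\<close> of both signs gives \<open>w - z' \<in> D\<^sup>\<bottom>\<close>, so \<open>(z, w)\<close> lies in the graph. The second part is the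
  first one applied to the inverse of \<open>T\<close>.
\<close>

text \<open>Near 0 the linear term dominates the quadratic one, so a nonzero \<open>a\<close> is
  refuted by a small \<open>t\<close> of the same sign. The choice \<open>t = a / B\<close>, with
  \<open>B\<close> positive and above \<open>b\<close>, works whatever the sign of
  \<open>b\<close>.\<close>

lemma linear_le_quadratic_imp_zero:
  fixes a b :: real
  assumes "\<And>t. t * a \<le> t\<^sup>2 * b"
  shows "a = 0"
proof (rule ccontr)
  assume "a \<noteq> 0"
  define B where "B = \<bar>b\<bar> + 1"
  have "B > 0" "b < B" by (auto simp: B_def)
  have "(a / B) * a \<le> (a / B)\<^sup>2 * b" by (rule assms)
  then have "a\<^sup>2 * B \<le> a\<^sup>2 * b"
    using \<open>B > 0\<close> by (simp add: field_simps power2_eq_square)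
  with \<open>a \<noteq> 0\<close> \<open>b < B\<close> show False by simp
qed

lemma monotone_operatorD:
  assumes "monotone_operator T" "(x, x') \<in> T" "(y, y') \<in> T"
  shows "(x - y) \<bullet> (x' - y') \<ge> 0"
  using assms unfolding monotone_operator_def by fast

lemma monotone_operator_converse:
  assumes "monotone_operator T"
  shows "monotone_operator (T\<inverse>)"
  using assms unfolding monotone_operator_def by (fastforce simp: inner_commute)

text \<open>Inversion is an involution that preserves inclusion and, by symmetry of the inner
  product, monotonicity. Hence a monotone extension of the inverse is the inverse of a monotone
  extension.\<close>

lemma maximally_monotone_converse:
  assumes "maximally_monotone T"
  shows "maximally_monotone (T\<inverse>)"
  unfolding maximally_monotone_def
proof (intro conjI allI impI)
  show "monotone_operator (T\<inverse>)"
    using assms monotone_operator_converse unfolding maximally_monotone_def by blast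
  fix S assume S: "monotone_operator S \<and> T\<inverse> \<subseteq> S"
  then have "monotone_operator (S\<inverse>)" "T \<subseteq> S\<inverse>"
    using monotone_operator_converse by auto
  with assms have "S\<inverse> = T"
    unfolding maximally_monotone_def by blast
  then show "S = T\<inverse>" by auto
qed

lemma subspace_Domain:
  fixes T :: "('a::real_vector \<times> 'b::real_vector) set"
  assumes "subspace T"
  shows "subspace (Domain T)"
  using linear_subspace_image[OF linear_fst assms] by (simp add: Domain_fst)

lemma subspace_converse:
  fixes T :: "('a::real_vector \<times> 'b::real_vector) set"
  assumes "subspace T"
  shows "subspace (T\<inverse>)"
proof -
  have "linear (prod.swap :: 'a \<times> 'b \<Rightarrow> 'b \<times> 'a)"
    by (rule linearI) auto
  moreover have "T\<inverse> = prod.swap ` T" by force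
  ultimately show ?thesis
    using assms linear_subspace_image by metis
qed

lemma operator_sum_normal_cone_Image:
  fixes T :: "'a::real_inner operator"
  assumes "subspace C"
  shows "(T \<oplus>\<^sub>o normal_cone C) `` {x} = (if x \<in> C then T `` {x} + C\<^sup>\<bottom> else {})"
proof -
  have "(T \<oplus>\<^sub>o normal_cone C) `` {x} = T `` {x} + normal_cone C `` {x}"
    by (auto simp: operator_sum_def)
  then show ?thesis
    by (simp add: normal_cone_subspace[OF assms] set_plus_def)
qed

lemma mem_operator_sum_normal_cone:
  fixes T :: "'a::real_inner operator"
  assumes "subspace C"
  shows "(x, u) \<in> T \<oplus>\<^sub>o normal_cone C \<longleftrightarrow>
    x \<in> C \<and> (\<exists>x' d. (x, x') \<in> T \<and> d \<in> C\<^sup>\<bottom> \<and> u = x' + d)"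
proof -
  have "(x, u) \<in> T \<oplus>\<^sub>o normal_cone C \<longleftrightarrow> u \<in> (T \<oplus>\<^sub>o normal_cone C) `` {x}"
    by simp
  then show ?thesis
    unfolding operator_sum_normal_cone_Image[OF assms] by (auto simp: set_plus_def)
qed

lemma orthogonal_compD: "x \<in> C \<Longrightarrow> d \<in> C\<^sup>\<bottom> \<Longrightarrow> x \<bullet> d = 0"
  by (simp add: orthogonal_comp_def orthogonal_def)

lemma zero_mem_orthogonal_comp: "0 \<in> C\<^sup>\<bottom>"
  by (simp add: orthogonal_comp_def orthogonal_clauses)

lemma subset_operator_sum_normal_cone:
  fixes T :: "'a::real_inner operator"
  assumes "subspace C" "Domain T \<subseteq> C"
  shows "T \<subseteq> T \<oplus>\<^sub>o normal_cone C"
proof (rule subrelI)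
  fix x x' assume T: "(x, x') \<in> T"
  then have "x \<in> C" using assms(2) by blast
  \<comment> \<open>The normal part is taken to be 0.\<close>
  moreover have "x' = x' + 0" by simp
  ultimately show "(x, x') \<in> T \<oplus>\<^sub>o normal_cone C"
    unfolding mem_operator_sum_normal_cone[OF assms(1)]
    using T zero_mem_orthogonal_comp by blast
qed

lemma Domain_operator_sum_normal_cone:
  fixes T :: "'a::real_inner operator"
  assumes "subspace C" "Domain T \<subseteq> C"
  shows "Domain (T \<oplus>\<^sub>o normal_cone C) = Domain T"
  using subset_operator_sum_normal_cone[OF assms] mem_operator_sum_normal_cone[OF assms(1)]
  by blast

text \<open>Differences of points of \<open>C\<close> stay in \<open>C\<close> and are orthogonal to
  both normal parts, so the inner product to be bounded is the one already controlled by
  \<open>T\<close>.\<close>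

lemma monotone_operator_sum_normal_cone:
  fixes T :: "'a::real_inner operator"
  assumes "subspace C" "monotone_operator T"
  shows "monotone_operator (T \<oplus>\<^sub>o normal_cone C)"
proof -
  have "(x - y) \<bullet> (u - v) \<ge> 0"
    if xu: "(x, u) \<in> T \<oplus>\<^sub>o normal_cone C" and yv: "(y, v) \<in> T \<oplus>\<^sub>o normal_cone C" for x u y v
  proof -
    from xu obtain x' d where x: "x \<in> C" "(x, x') \<in> T" "d \<in> C\<^sup>\<bottom>" "u = x' + d"
      unfolding mem_operator_sum_normal_cone[OF assms(1)] by blast
    from yv obtain y' e where y: "y \<in> C" "(y, y') \<in> T" "e \<in> C\<^sup>\<bottom>" "v = y' + e"
      unfolding mem_operator_sum_normal_cone[OF assms(1)] by blast
    have "x - y \<in> C" using assms(1) x y by (simp add: subspace_diff)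
    then have "(x - y) \<bullet> d = 0" "(x - y) \<bullet> e = 0"
      using x y orthogonal_compD by blast+
    then have "(x - y) \<bullet> (u - v) = (x - y) \<bullet> (x' - y')"
      using x y by (simp add: inner_diff_right inner_add_right)
    then show ?thesis
      using monotone_operatorD[OF assms(2) x(2) y(2)] by simp
  qed
  then show ?thesis
    unfolding monotone_operator_def by blast
qed

lemma maximally_monotone_sum_normal_cone_Domain:
  fixes T :: "'a::euclidean_space operator"
  assumes "subspace T" "monotone_operator T"
  shows "maximally_monotone (T \<oplus>\<^sub>o normal_cone (Domain T))"
proof -
  let ?D = "Domain T"
  let ?T1 = "T \<oplus>\<^sub>o normal_cone ?D"
  note D = subspace_Domain[OF assms(1)]
  note mem = mem_operator_sum_normal_cone[OF D]
  have "(z, w) \<in> ?T1" if S: "monotone_operator S" "?T1 \<subseteq> S" "(z, w) \<in> S" for S z w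
  proof -
    \<comment> \<open>Nothing else about \<open>S\<close> is used below: \<open>(z, w)\<close> is
      monotonically related to every point of \<open>?T1\<close>.\<close>
    have rel: "(z - x) \<bullet> (w - (x' + d)) \<ge> 0" if "(x, x') \<in> T" "d \<in> ?D\<^sup>\<bottom>" for x x' d
    proof -
      have "(x, x' + d) \<in> S" using S(2) mem that by blast
      then show ?thesis using monotone_operatorD[OF S(1,3)] by blast
    qed
    \<comment> \<open>The orthogonal decomposition is phrased for spans; it is the step that relies
      on finite dimension.\<close>
    have span: "span ?D = ?D" using D by (rule span_eq_iff[THEN iffD2])
    obtain p q where pq: "p \<in> ?D" "\<And>v. v \<in> ?D \<Longrightarrow> orthogonal q v" "z = p + q"
      using orthogonal_subspace_decomp_exists[of ?D z] unfolding span by blast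
    have q: "q \<in> ?D\<^sup>\<bottom>"
      unfolding orthogonal_comp_def using pq(2) orthogonal_commute by blast
    obtain p' where p': "(p, p') \<in> T" using pq by blast
    \<comment> \<open>Since \<open>z - p = q\<close>, \<open>rel\<close> with
      \<open>d = t *\<^sub>R q\<close> bounds a linear function of \<open>t\<close> from above, so
      its slope must vanish.\<close>
    have "t * (q \<bullet> q) \<le> q \<bullet> (w - p')" for t
    proof -
      have "t *\<^sub>R q \<in> ?D\<^sup>\<bottom>"
        using q by (simp add: subspace_orthogonal_comp subspace_scale)
      from rel[OF p' this] show ?thesis
        using pq(3) by (simp add: inner_diff_right inner_add_right)
    qed
    \<comment> \<open>For nonzero \<open>q\<close>, this \<open>t\<close> makes the left side exceed
      the bound by exactly 1.\<close>
    from this[of "(q \<bullet> (w - p') + 1) / (q \<bullet> q)"] have "q = 0"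
      by (cases "q = 0") auto
    with pq obtain z' where z': "(z, z') \<in> T" by auto
    have "v \<bullet> (w - z') = 0" if v: "v \<in> ?D" for v
    proof -
      obtain v' where v': "(v, v') \<in> T" using v by blast
      \<comment> \<open>Here \<open>z\<close> minus the test point is
        \<open>- t *\<^sub>R v\<close>, and the normal part is 0. Linearity of \<open>T\<close>
        admits every real \<open>t\<close>, hence both signs.\<close>
      have "t * (v \<bullet> (w - z')) \<le> t\<^sup>2 * (v \<bullet> v')" for t
      proof -
        have "(z, z') + t *\<^sub>R (v, v') \<in> T"
          using assms(1) z' v' by (intro subspace_add subspace_scale)
        then have "(z + t *\<^sub>R v, z' + t *\<^sub>R v') \<in> T" by simp
        from rel[OF this zero_mem_orthogonal_comp] show ?thesis
          by (simp add: inner_diff_right inner_add_right power2_eq_square algebra_simps)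
      qed
      then show ?thesis by (rule linear_le_quadratic_imp_zero)
    qed
    then have "w - z' \<in> ?D\<^sup>\<bottom>"
      by (simp add: orthogonal_comp_def orthogonal_def)
    moreover have "w = z' + (w - z')" by simp
    ultimately show ?thesis
      unfolding mem using z' by blast
  qed
  then show ?thesis
    unfolding maximally_monotone_def
    using monotone_operator_sum_normal_cone[OF D assms(2)] by fast
qed

theorem proposition5p1:
  fixes T :: "(real ^ 'n) operator"
  assumes "subspace T"
    and "monotone_operator T"
  shows
    "((\<forall>x. (T \<oplus>\<^sub>o normal_cone (Domain T)) `` {x} =
            (if x \<in> Domain T then T `` {x} + (Domain T)\<^sup>\<bottom> else {}))
      \<and> maximally_monotone (T \<oplus>\<^sub>o normal_cone (Domain T))
      \<and> Domain (T \<oplus>\<^sub>o normal_cone (Domain T)) = Domain T)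
     \<and>
     (maximally_monotone ((T\<inverse> \<oplus>\<^sub>o normal_cone (Range T))\<inverse>)
      \<and> T \<subseteq> (T\<inverse> \<oplus>\<^sub>o normal_cone (Range T))\<inverse>
      \<and> Range ((T\<inverse> \<oplus>\<^sub>o normal_cone (Range T))\<inverse>) = Range T)"
proof -
  note D = subspace_Domain[OF assms(1)]
  note inv = subspace_converse[OF assms(1)] monotone_operator_converse[OF assms(2)]
  \<comment> \<open>The range of \<open>T\<close> is the domain of its inverse, which is again a
    monotone linear relation, so the results on domains apply to it.\<close>
  have R: "subspace (Range T)" using subspace_Domain[OF inv(1)] by simp
  have "maximally_monotone ((T\<inverse> \<oplus>\<^sub>o normal_cone (Range T))\<inverse>)"
    using maximally_monotone_converse[OF maximally_monotone_sum_normal_cone_Domain[OF inv]]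
    by simp
  moreover have "T \<subseteq> (T\<inverse> \<oplus>\<^sub>o normal_cone (Range T))\<inverse>"
    using subset_operator_sum_normal_cone[OF R, of "T\<inverse>"] by auto
  moreover have "Range ((T\<inverse> \<oplus>\<^sub>o normal_cone (Range T))\<inverse>) = Range T"
    using Domain_operator_sum_normal_cone[OF R, of "T\<inverse>"] by simp
  ultimately show ?thesis
    using operator_sum_normal_cone_Image[OF D] Domain_operator_sum_normal_cone[OF D]
      maximally_monotone_sum_normal_cone_Domain[OF assms]
    by blast
qed

end
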